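(* Let either $a,b\in(-1,\infty)$ with $ab>0$, or $a,b\in\mathbb{C}\setminus\{0\}$ with $b=\overline{a}$. Let $c$ be a positive real number, $\alpha\in\mathbb{D}$, and define for $z\in\mathbb{D}$ $$f_1(z)=z+\overline{\tfrac{\alpha}{2}zF(a,b;c;z)},\quad f_2(z)=z+\overline{\tfrac{\alpha}{2}\bigl(F(a,b;c;z)-1\bigr)},\quad f_3(z)=z+\overline{\tfrac{\alpha}{2}\int_0^zF(a,b;c;t)\,dt}.$$ (a) If $c>\operatorname{Re}(a+b)+1$ and $$|\alpha|\frac{\Gamma(c)\Gamma(c-a-b-1)}{\Gamma(c-a)\Gamma(c-b)}(ab+c-a-b-1)\le1,$$ then $f_1\in\mathcal{US}^*_H$. (b) If $c>\operatorname{Re}(a+b)+1$ and $$ab|\alpha|\frac{\Gamma(c)\Gamma(c-a-b-1)}{\Gamma(c-a)\Gamma(c-b)}\le1,$$ then $f_2\in\mathcal{US}^*_H$. (c) If $c>\operatorname{Re}(a+b)$ and $$|\alpha|\frac{\Gamma(c)\Gamma(c-a-b)}{\Gamma(c-a)\Gamma(c-b)}\le1,$$ then $f_3\in\mathcal{US}^*_H$.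
   Context: $\mathbb{D}=\{z\in\mathbb{C}:|z|<1\}$. $F(a,b;c;z)=\sum_{n=0}^\infty\frac{(a)_n(b)_n}{(c)_n\,n!}z^n$, $|z|<1$, is the Gaussian hypergeometric function, where $(a)_0=1$ and $(a)_n=a(a+1)\cdots(a+n-1)$. $\mathcal{H}$ is the class of complex-valued harmonic functions $f=h+\overline{g}$ in $\mathbb{D}$, with $h,g$ analytic in $\mathbb{D}$ and $h(z)=z+\sum_{n\ge2}a_nz^n$, $g(z)=\sum_{n\ge1}b_nz^n$. $\mathcal{S}_H$ is the class of $f\in\mathcal{H}$ that are univalent and sense-preserving ($J_f=|h'|^2-|g'|^2>0$) in $\mathbb{D}$. A function $f\in C^1(\mathbb{D})$ is uniformly starlike in $\mathbb{D}$ if $f$ is fully starlike in $\mathbb{D}$ (each circle $|z|=r$, $0<r<1$, is mapped one-to-one onto a curve bounding a domain starlike with respect to the origin) and $f$ maps every circular arc $\gamma_\zeta$ contained in $\mathbb{D}$ with center $\zeta\in\mathbb{D}$ to an arc $f(\gamma_\zeta)$ which is starlike with respect to $f(\zeta)$ (i.e. $\arg(f(z)-f(\zeta))$ is nondecreasing as $z$ traverses $\gamma_\zeta$ positively). $\mathcal{US}^*_H$ is the class of all $f\in\mathcal{S}_H$ that are uniformly starlike in $\mathbb{D}$. *)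

theory Defs
  imports "HOL-Complex_Analysis.Complex_Analysis"
begin

abbreviation unit_disc :: "complex set" where
  "unit_disc \<equiv> ball 0 1"

definition hyp2F1 :: "complex \<Rightarrow> complex \<Rightarrow> complex \<Rightarrow> complex \<Rightarrow> complex" where
  "hyp2F1 a b c z = (\<Sum>n. pochhammer a n * pochhammer b n / (pochhammer c n * fact n) * z ^ n)"

(* The analytic and co-analytic parts of f on the unit disc.  The coefficients start at index 2
   for h and at index 1 for g, so g 0 = 0 and the pair (h, g) is unique on the disc.  All
   properties concern the restriction of f to the disc; values elsewhere are irrelevant. *)
definition canonical_decomposition ::
    "(complex \<Rightarrow> complex) \<Rightarrow> (complex \<Rightarrow> complex) \<Rightarrow> (complex \<Rightarrow> complex) \<Rightarrow> bool" where
  "canonical_decomposition f h g \<longleftrightarrow>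
     h analytic_on unit_disc \<and> g analytic_on unit_disc \<and>
     (\<exists>a. \<forall>z\<in>unit_disc. (\<lambda>n. a (n + 2) * z ^ (n + 2)) sums (h z - z)) \<and>
     (\<exists>b. \<forall>z\<in>unit_disc. (\<lambda>n. b (n + 1) * z ^ (n + 1)) sums g z) \<and>
     (\<forall>z\<in>unit_disc. f z = h z + cnj (g z))"

definition class_H :: "(complex \<Rightarrow> complex) set" where
  "class_H = {f. \<exists>h g. canonical_decomposition f h g}"

definition sense_preserving :: "(complex \<Rightarrow> complex) \<Rightarrow> bool" where
  "sense_preserving f \<longleftrightarrow>
     (\<exists>h g. canonical_decomposition f h g \<and>
        (\<forall>z\<in>unit_disc. (norm (deriv h z))\<^sup>2 - (norm (deriv g z))\<^sup>2 > 0))"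

definition class_SH :: "(complex \<Rightarrow> complex) set" where
  "class_SH = {f \<in> class_H. inj_on f unit_disc \<and> sense_preserving f}"

(* Continuous differentiability in the real sense: the derivative is an \<real>-linear map. *)
definition C1_on :: "complex set \<Rightarrow> (complex \<Rightarrow> complex) \<Rightarrow> bool" where
  "C1_on S f \<longleftrightarrow>
     (\<exists>f' :: complex \<Rightarrow> complex \<Rightarrow>\<^sub>L complex.
        (\<forall>z\<in>S. (f has_derivative blinfun_apply (f' z)) (at z)) \<and> continuous_on S f')"

definition starlike_wrt :: "complex \<Rightarrow> complex set \<Rightarrow> bool" where
  "starlike_wrt p S \<longleftrightarrow> p \<in> S \<and> (\<forall>w\<in>S. closed_segment p w \<subseteq> S)"

(* For continuous f that is injective on the circle, the image is a Jordan curve and inside of it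
   is the domain it bounds. *)
definition fully_starlike :: "(complex \<Rightarrow> complex) \<Rightarrow> bool" where
  "fully_starlike f \<longleftrightarrow>
     (\<forall>r. 0 < r \<and> r < 1 \<longrightarrow>
        inj_on f (sphere 0 r) \<and> starlike_wrt 0 (inside (f ` sphere 0 r)))"

(* The argument of \<gamma> t - w is understood as a continuous branch \<phi> along the curve; any two such
   branches differ by a constant, so monotonicity does not depend on the choice. *)
definition curve_starlike_wrt :: "complex \<Rightarrow> (real \<Rightarrow> complex) \<Rightarrow> real \<Rightarrow> real \<Rightarrow> bool" where
  "curve_starlike_wrt w \<gamma> s u \<longleftrightarrow>
     (\<exists>\<phi>. continuous_on {s..u} \<phi> \<and> mono_on {s..u} \<phi> \<and>
        (\<forall>t\<in>{s..u}. \<gamma> t \<noteq> w \<and> \<gamma> t - w = of_real (norm (\<gamma> t - w)) * cis (\<phi> t)))"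

definition uniformly_starlike :: "(complex \<Rightarrow> complex) \<Rightarrow> bool" where
  "uniformly_starlike f \<longleftrightarrow>
     C1_on unit_disc f \<and> fully_starlike f \<and>
     (\<forall>\<zeta>\<in>unit_disc. \<forall>\<rho>>0. \<forall>s u. s < u \<and> u \<le> s + 2 * pi \<and>
        (\<forall>t\<in>{s..u}. \<zeta> + of_real \<rho> * cis t \<in> unit_disc) \<longrightarrow>
        curve_starlike_wrt (f \<zeta>) (\<lambda>t. f (\<zeta> + of_real \<rho> * cis t)) s u)"

definition class_US :: "(complex \<Rightarrow> complex) set" where
  "class_US = {f \<in> class_SH. uniformly_starlike f}"

definition f1 :: "complex \<Rightarrow> complex \<Rightarrow> real \<Rightarrow> complex \<Rightarrow> complex \<Rightarrow> complex" where
  "f1 a b c \<alpha> z = z + cnj (\<alpha> / 2 * z * hyp2F1 a b (of_real c) z)"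

definition f2 :: "complex \<Rightarrow> complex \<Rightarrow> real \<Rightarrow> complex \<Rightarrow> complex \<Rightarrow> complex" where
  "f2 a b c \<alpha> z = z + cnj (\<alpha> / 2 * (hyp2F1 a b (of_real c) z - 1))"

definition f3 :: "complex \<Rightarrow> complex \<Rightarrow> real \<Rightarrow> complex \<Rightarrow> complex \<Rightarrow> complex" where
  "f3 a b c \<alpha> z = z + cnj (\<alpha> / 2 * contour_integral (linepath 0 z) (hyp2F1 a b (of_real c)))"

(* \<Gamma>(c) \<Gamma>(c - a - b - k) / (\<Gamma>(c - a) \<Gamma>(c - b)).  For a, b both real or b = cnj a, and c real,
   this is a real number, as are a * b and a + b; hence inequalities between such quantities may
   be stated through Re. *)
definition gamma_ratio :: "complex \<Rightarrow> complex \<Rightarrow> real \<Rightarrow> nat \<Rightarrow> complex" where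
  "gamma_ratio a b c k =
     Gamma (of_real c) * Gamma (of_real c - a - b - of_nat k) /
     (Gamma (of_real c - a) * Gamma (of_real c - b))"

end

theory Submission
  imports Defs
begin

text \<open>
  All three functions have the form \<open>f z = z + cnj (g z)\<close> with \<open>g\<close> holomorphic, and in each case the
  hypothesis ensures \<open>norm (g' z) \<le> 1/2\<close> on the disc. That bound alone implies uniform
  starlikeness (\<open>class_US_of_deriv_le_half\<close>). For \<open>z = \<zeta> + u\<close> with \<open>u\<close> on a circle about \<open>0\<close>, the
  vector from \<open>f \<zeta>\<close> to \<open>f z\<close> is \<open>u (1 + B)\<close> and the tangent of the image curve is \<open>\<i> u (1 + A)\<close>,
  where \<open>A\<close> and \<open>B\<close> have norm at most \<open>1/2\<close>. Both factors have argument at most \<open>\<pi>/6\<close>, so their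
  quotient has positive real part, and this real part is the angular velocity of the image curve
  (\<open>curve_starlike_perturbation\<close>).

  For circles about the origin, starlikeness is required of the domain that the curve bounds. This
  domain is the image of the disc (\<open>inside_image_sphere\<close>). The map \<open>F z = z + cnj (G z)\<close>, with \<open>G\<close> a
  \<open>1/2\<close>-Lipschitz extension of \<open>g\<close> to the plane, is a bijection of the plane, and the same angle
  estimate shows that moving \<open>F z\<close> along the ray towards the origin does not increase the norm of the
  preimage (\<open>contraction_perturbation_starlike\<close>).

  It remains to bound the derivative. The coefficients of the hypergeometric series are nonnegative,
  so its norm on the disc is at most its value at \<open>1\<close>, and that value is at most the gamma quotient.
  This inequality, one half of Gauss's summation theorem, follows from the contiguity relation between \<open>c\<close>
  and \<open>c + 1\<close> for partial sums, whose boundary term has a favourable sign: iterating the relation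
  moves \<open>c\<close> to infinity, where the partial sums tend to \<open>1\<close> and the accumulated factors tend to the
  gamma quotient (\<open>gauss_partial_sum_le\<close>). The derivative of the series is again hypergeometric, with
  all parameters raised by one, which gives the remaining two constants.
\<close>

section \<open>Perturbations of the identity by a contraction\<close>

text \<open>
  Numbers within \<open>1/2\<close> of \<open>1\<close> have argument at most \<open>\<pi>/6\<close>, so two of them enclose an angle of at
  most \<open>\<pi>/3\<close>. The polarisation identity gives this without arguments; since the parallelogram law
  bounds the sum and the difference of the perturbations together, the bound stays away from \<open>0\<close>.
\<close>
lemma Re_mult_cnj_perturbed_units:
  fixes A B :: complex
  assumes "norm A \<le> 1/2" "norm B \<le> 1/2"
  shows "Re ((1 + B) * cnj (1 + A)) \<ge> 1/4"
proof -
  have par: "(norm (A + B))\<^sup>2 + (norm (B - A))\<^sup>2 \<le> 1"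
  proof -
    have "(norm (A + B))\<^sup>2 + (norm (B - A))\<^sup>2 = 2 * ((norm A)\<^sup>2 + (norm B)\<^sup>2)"
      unfolding cmod_power2 by (simp add: power2_eq_square algebra_simps)
    also have "\<dots> \<le> 2 * ((1/2)\<^sup>2 + (1/2)\<^sup>2)"
      using assms by (intro mult_left_mono add_mono power_mono) auto
    finally show ?thesis by (simp add: power2_eq_square)
  qed
  define x where "x = norm (A + B)"
  have x: "0 \<le> x" "x \<le> 1" using norm_triangle_ineq[of A B] assms by (auto simp: x_def)
  have "2 - x \<le> norm (2 + (A + B))" using norm_diff_ineq[of 2 "A + B"] by (simp add: x_def)
  hence "(2 - x)\<^sup>2 \<le> (norm (2 + (A + B)))\<^sup>2" using x by (intro power_mono) auto
  moreover have "4 * Re ((1 + B) * cnj (1 + A)) = (norm (2 + (A + B)))\<^sup>2 - (norm (B - A))\<^sup>2"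
    unfolding cmod_power2 by (simp add: power2_eq_square algebra_simps)
  ultimately have "4 * Re ((1 + B) * cnj (1 + A)) \<ge> (2 - x)\<^sup>2 - (1 - x\<^sup>2)"
    using par by (simp add: x_def)
  also have "(2 - x)\<^sup>2 - (1 - x\<^sup>2) = 2 * (x - 1)\<^sup>2 + 1" by (simp add: power2_eq_square algebra_simps)
  finally show ?thesis using zero_le_power2[of "x - 1"] by linarith
qed

text \<open>
  The vector \<open>1 + B\<close> makes an acute angle with \<open>1 + A\<close>, so a short step against it does not increase
  the norm. The admissible step \<open>2/9\<close> is \<open>2 \<cdot> (1/4) / (3/2)\<^sup>2\<close>, where \<open>1/4\<close> bounds the inner
  product from below and \<open>3/2\<close> bounds the norm of \<open>1 + B\<close>.
\<close>
lemma norm_sub_scaled_perturbed_unit_le: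
  fixes A B :: complex and \<epsilon> :: real
  assumes "norm A \<le> 1/2" "norm B \<le> 1/2" and \<epsilon>: "0 \<le> \<epsilon>" "\<epsilon> \<le> 2/9"
  shows "norm (1 + A - of_real \<epsilon> * (1 + B)) \<le> norm (1 + A)"
proof -
  have "norm (1 + B) \<le> 3/2" using norm_triangle_ineq[of 1 B] assms(2) by simp
  hence "(norm (1 + B))\<^sup>2 \<le> (3/2)\<^sup>2" by (intro power_mono) auto
  hence "\<epsilon> * (norm (1 + B))\<^sup>2 \<le> 2/9 * (3/2)\<^sup>2" using \<epsilon> by (intro mult_mono) auto
  also have "\<dots> \<le> 2 * Re ((1 + B) * cnj (1 + A))"
    using Re_mult_cnj_perturbed_units[OF assms(1,2)] by (simp add: power2_eq_square)
  finally have le: "\<epsilon> * (\<epsilon> * (norm (1 + B))\<^sup>2) \<le> \<epsilon> * (2 * Re ((1 + B) * cnj (1 + A)))"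
    using \<epsilon>(1) by (rule mult_left_mono)
  have "(norm (1 + A - of_real \<epsilon> * (1 + B)))\<^sup>2 =
      (norm (1 + A))\<^sup>2 - 2 * \<epsilon> * Re ((1 + B) * cnj (1 + A)) + \<epsilon>\<^sup>2 * (norm (1 + B))\<^sup>2"
    unfolding cmod_power2 by (simp add: power2_eq_square algebra_simps)
  also have "\<dots> \<le> (norm (1 + A))\<^sup>2" using le by (simp add: power2_eq_square algebra_simps)
  finally show ?thesis by (rule power2_le_imp_le) simp
qed

text \<open>
  The image of the open ball is connected, and it is open by invariance of domain. The complement of
  the image of the closed ball is connected because a homeomorphic image of a compact convex set does
  not separate the plane, and it is unbounded. Hence these two sets are the bounded and the unbounded
  component of the complement of the image of the sphere.
\<close>
lemma inside_image_sphere: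
  fixes f :: "complex \<Rightarrow> complex"
  assumes cont: "continuous_on (cball a r) f" and inj: "inj_on f (cball a r)" and r: "0 < r"
  shows "inside (f ` sphere a r) = f ` ball a r"
proof -
  let ?S = "f ` sphere a r"
  have disj: "f ` ball a r \<inter> ?S = {}" "f ` cball a r = f ` ball a r \<union> ?S"
    using inj sphere_cball[of a r] by (force simp: inj_on_def)+
  have bdd: "bounded (f ` cball a r)"
    by (intro compact_imp_bounded compact_continuous_image cont) simp
  have conn: "connected (- f ` cball a r)"
  proof (rule connected_complement_homeomorphic_convex_compact)
    show "f ` cball a r homeomorphic cball a r"
      using compact_cball cont homeomorphic_compact homeomorphic_sym inj by blast
  qed auto
  have "closed ?S"
    by (intro compact_imp_closed compact_continuous_image continuous_on_subset[OF cont]) auto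
  show ?thesis
  proof
    show "inside ?S \<subseteq> f ` ball a r"
    proof
      fix w assume w: "w \<in> inside ?S"
      show "w \<in> f ` ball a r"
      proof (rule ccontr)
        assume "w \<notin> f ` ball a r"
        with w disj(2) have "w \<in> - f ` cball a r" by (auto simp: inside_def)
        hence "- f ` cball a r \<subseteq> connected_component_set (- ?S) w"
          using disj(2) conn by (intro connected_component_maximal) auto
        hence "bounded (- f ` cball a r)" using w by (auto simp: inside_def intro: bounded_subset)
        thus False using bdd cobounded_imp_unbounded by blast
      qed
    qed
    show "f ` ball a r \<subseteq> inside ?S"
    proof
      fix w assume w: "w \<in> f ` ball a r"
      let ?C = "connected_component_set (- ?S) w"
      have "?C \<subseteq> f ` ball a r"
      proof (rule ccontr)
        assume "\<not> ?C \<subseteq> f ` ball a r"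
        moreover have "?C \<subseteq> - ?S" by (rule connected_component_subset)
        moreover have "w \<in> ?C" using w disj(1) by auto
        moreover have "open (f ` ball a r)" by (rule invariance_of_domain_ball[OF cont r inj])
        moreover have "open (- f ` cball a r)"
          using compact_continuous_image[OF cont] by (auto intro: compact_imp_closed)
        moreover have "connected ?C" by simp
        moreover have "?C \<subseteq> f ` ball a r \<union> (- f ` cball a r)"
          using \<open>?C \<subseteq> - ?S\<close> unfolding disj(2) by blast
        moreover have "f ` ball a r \<inter> (- f ` cball a r) \<inter> ?C = {}" unfolding disj(2) by blast
        ultimately have "f ` ball a r \<inter> ?C = {} \<or> (- f ` cball a r) \<inter> ?C = {}"
          by (intro connectedD)
        thus False
          using w \<open>w \<in> ?C\<close> \<open>\<not> ?C \<subseteq> _\<close> \<open>?C \<subseteq> f ` ball a r \<union> _\<close> by blast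
      qed
      hence "bounded ?C" using bdd disj(2) by (auto intro: bounded_subset)
      thus "w \<in> inside ?S" using w disj(1) by (auto simp: inside_def)
    qed
  qed
qed

text \<open>
  Write \<open>F z = z + cnj (G z)\<close>. Then \<open>F z = z (1 + B)\<close> and \<open>F z - F w = (z - w) (1 + A)\<close> with \<open>A\<close>, \<open>B\<close>
  of norm at most \<open>1/2\<close>, and \<open>F w = (1 - \<epsilon>) F z\<close> becomes
  \<open>w (1 + A) = z (1 + A - \<epsilon> (1 + B))\<close>. So pulling \<open>F z\<close> slightly towards the origin does not push
  its preimage outwards.
\<close>
lemma contraction_perturbation_starlike_step:
  fixes G :: "complex \<Rightarrow> complex"
  assumes lip: "\<And>x y. norm (G x - G y) \<le> norm (x - y) / 2" and G0: "G 0 = 0"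
    and \<epsilon>: "0 \<le> \<epsilon>" "\<epsilon> \<le> 2/9"
    and eq: "w + cnj (G w) = of_real (1 - \<epsilon>) * (z + cnj (G z))"
  shows "norm w \<le> norm z"
proof (cases "w = z \<or> z = 0")
  case True
  show ?thesis
  proof (cases "w = z")
    case False
    hence "z = 0" using True by simp
    hence "w = - cnj (G w)" using eq G0 by (simp add: eq_neg_iff_add_eq_0)
    hence "norm w = norm (G w)" by (metis norm_minus_cancel complex_mod_cnj)
    thus ?thesis using lip[of w 0] G0 by simp
  qed simp
next
  case False
  define A where "A = cnj (G z - G w) / (z - w)"
  define B where "B = cnj (G z) / z"
  have nz: "z \<noteq> 0" "z - w \<noteq> 0" using False by auto
  have "norm A \<le> 1/2" "norm B \<le> 1/2"
    using lip[of z w] lip[of z 0] nz G0 by (auto simp: A_def B_def norm_divide divide_simps simp flip: complex_cnj_diff)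
  note * = norm_sub_scaled_perturbed_unit_le[OF this \<epsilon>]
  have A: "(z - w) * (1 + A) = z + cnj (G z) - (w + cnj (G w))" using nz by (simp add: A_def field_simps)
  have B: "z * (1 + B) = z + cnj (G z)" using nz by (simp add: B_def field_simps)
  have "(z - w) * (1 + A) = of_real \<epsilon> * (z * (1 + B))"
    unfolding A B eq by (simp add: algebra_simps)
  hence "w * (1 + A) = z * (1 + A - of_real \<epsilon> * (1 + B))" by (simp add: algebra_simps)
  hence "norm w * norm (1 + A) = norm z * norm (1 + A - of_real \<epsilon> * (1 + B))"
    by (metis norm_mult)
  also have "\<dots> \<le> norm z * norm (1 + A)" using * by (intro mult_left_mono) auto
  finally have le: "norm w * norm (1 + A) \<le> norm z * norm (1 + A)" .
  have "norm (1 + A) > 0" using \<open>norm A \<le> 1/2\<close> norm_diff_ineq[of 1 A] by (auto simp del: zero_less_norm_iff)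
  with le show ?thesis by simp
qed

text \<open>
  A solution is a fixed point of the contraction \<open>\<lambda>z. w - cnj (G z)\<close>.
\<close>
lemma contraction_perturbation_surj:
  fixes G :: "complex \<Rightarrow> complex"
  assumes lip: "\<And>x y. norm (G x - G y) \<le> norm (x - y) / 2"
  obtains z where "z + cnj (G z) = w"
proof -
  have "\<exists>!z. w - cnj (G z) = z"
    using lip by (intro banach_fix_type[of "1/2"])
      (auto simp: dist_norm norm_minus_commute simp flip: complex_cnj_diff)
  then obtain z where "w - cnj (G z) = z" by blast
  hence "z + cnj (G z) = w" by (simp add: algebra_simps)
  thus ?thesis by (rule that)
qed

text \<open>
  A factor \<open>t\<close> that is too small for a single step is a power of a root \<open>\<mu> \<ge> 7/9\<close> of \<open>t\<close>, and the
  step is iterated. The intermediate preimages exist because \<open>G\<close> is a contraction of the whole plane.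
\<close>
lemma contraction_perturbation_starlike:
  fixes G :: "complex \<Rightarrow> complex" and t :: real
  assumes lip: "\<And>x y. norm (G x - G y) \<le> norm (x - y) / 2" and G0: "G 0 = 0"
    and t: "0 \<le> t" "t \<le> 1"
    and eq: "w + cnj (G w) = of_real t * (z + cnj (G z))"
  shows "norm w \<le> norm z"
proof (cases "t = 0")
  case True
  hence "w + cnj (G w) = of_real (1 - 0) * (0 + cnj (G 0))" using eq G0 by simp
  from contraction_perturbation_starlike_step[OF lip G0 _ _ this] show ?thesis by simp
next
  case False
  hence t0: "t > 0" using t by simp
  have "(\<lambda>k. root (Suc k) t) \<longlonglongrightarrow> 1" using LIMSEQ_Suc[OF LIMSEQ_root_const[OF t0]] .
  hence "eventually (\<lambda>k. root (Suc k) t > 7/9) sequentially" by (rule order_tendstoD) simp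
  then obtain k where k: "root (Suc k) t > 7/9" by (auto simp: eventually_sequentially)
  define \<mu> where "\<mu> = root (Suc k) t"
  have \<mu>: "\<mu> \<ge> 7/9" "\<mu> \<le> 1" "\<mu> ^ Suc k = t"
    using k t t0 by (auto simp: \<mu>_def real_root_le_1_iff simp del: power_Suc)
  have "norm w' \<le> norm z" if "w' + cnj (G w') = of_real (\<mu> ^ j) * (z + cnj (G z))" for w' j
    using that
  proof (induction j arbitrary: w')
    case 0
    thus ?case using contraction_perturbation_starlike_step[OF lip G0, of 0 w' z] by simp
  next
    case (Suc j)
    obtain v where v: "v + cnj (G v) = of_real (\<mu> ^ j) * (z + cnj (G z))"
      by (rule contraction_perturbation_surj[OF lip])
    have "w' + cnj (G w') = of_real (1 - (1 - \<mu>)) * (v + cnj (G v))"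
      unfolding v Suc.prems by simp
    hence "norm w' \<le> norm v"
      using \<mu> by (intro contraction_perturbation_starlike_step[OF lip G0, of "1 - \<mu>"]) auto
    with Suc.IH[OF v] show ?case by simp
  qed
  thus ?thesis using eq \<mu>(3) by metis
qed

lemma lipschitz_of_deriv_le_half:
  assumes holo: "g holomorphic_on unit_disc"
    and bound: "\<And>z. z \<in> unit_disc \<Longrightarrow> norm (deriv g z) \<le> 1/2"
    and "x \<in> unit_disc" "y \<in> unit_disc"
  shows "norm (g x - g y) \<le> norm (x - y) / 2"
proof -
  have deriv: "(g has_field_derivative deriv g z) (at z within unit_disc)" if "z \<in> unit_disc" for z
    by (rule has_field_derivative_at_within[OF holomorphic_derivI[OF holo open_ball that]])
  have "norm (g x - g y) \<le> 1/2 * norm (x - y)"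
    by (rule field_differentiable_bound[where S = unit_disc and f' = "deriv g", OF _ deriv bound assms(3,4)])
       (rule convex_ball)
  thus ?thesis by simp
qed

lemma inj_on_perturbation:
  assumes lip: "\<And>x y. x \<in> S \<Longrightarrow> y \<in> S \<Longrightarrow> norm (g x - g y) \<le> norm (x - y) / 2"
  shows "inj_on (\<lambda>z. z + cnj (g z)) S"
proof (rule inj_onI)
  fix x y assume xy: "x \<in> S" "y \<in> S" "x + cnj (g x) = y + cnj (g y)"
  hence "x - y = - cnj (g x - g y)" by (simp add: algebra_simps)
  hence "norm (x - y) = norm (g x - g y)" by (metis norm_minus_cancel complex_mod_cnj)
  with lip[OF xy(1,2)] show "x = y" by simp
qed

text \<open>
  The inside of the image curve is the image of the disc of radius \<open>r\<close>. A preimage of a point on the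
  segment from \<open>0\<close> to \<open>w\<close> should be found in that disc; its existence there is not clear in advance.
  Precomposing \<open>g\<close> with the nearest-point projection onto the disc, which does not increase distances,
  extends the map to the plane, where the preimage exists and has norm at most that of the preimage
  of \<open>w\<close>. It therefore lies in the disc, where the extension agrees with the original map.
\<close>
lemma fully_starlike_perturbation:
  fixes g :: "complex \<Rightarrow> complex"
  assumes lip: "\<And>x y. x \<in> unit_disc \<Longrightarrow> y \<in> unit_disc \<Longrightarrow> norm (g x - g y) \<le> norm (x - y) / 2"
    and cont: "continuous_on unit_disc g" and g0: "g 0 = 0"
  shows "fully_starlike (\<lambda>z. z + cnj (g z))" (is "fully_starlike ?f")
  unfolding fully_starlike_def
proof (intro allI impI conjI)
  fix r :: real assume r: "0 < r \<and> r < 1"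
  have sub: "cball 0 r \<subseteq> unit_disc" using r by auto
  have inj: "inj_on ?f unit_disc" by (rule inj_on_perturbation[OF lip])
  show "inj_on ?f (sphere 0 r)" using sub by (intro inj_on_subset[OF inj]) auto
  have ins: "inside (?f ` sphere 0 r) = ?f ` ball 0 r"
  proof (rule inside_image_sphere)
    show "continuous_on (cball 0 r) ?f" by (intro continuous_intros continuous_on_subset[OF cont] sub)
    show "inj_on ?f (cball 0 r)" by (rule inj_on_subset[OF inj sub])
  qed (use r in auto)
  define \<pi> where "\<pi> = closest_point (cball 0 r :: complex set)"
  have \<pi>_in: "\<pi> z \<in> cball 0 r" for z
    unfolding \<pi>_def using r by (intro closest_point_in_set) auto
  have \<pi>_self: "\<pi> z = z" if "norm z \<le> r" for z
    unfolding \<pi>_def using that by (intro closest_point_self) auto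
  define G where "G = g \<circ> \<pi>"
  have lipG: "norm (G x - G y) \<le> norm (x - y) / 2" for x y
  proof -
    have "norm (G x - G y) \<le> norm (\<pi> x - \<pi> y) / 2"
      unfolding G_def o_def using \<pi>_in sub by (intro lip) blast+
    also have "norm (\<pi> x - \<pi> y) \<le> norm (x - y)"
      unfolding \<pi>_def dist_norm[symmetric] using r by (intro closest_point_lipschitz) auto
    finally show ?thesis by simp
  qed
  have G0: "G 0 = 0" using r g0 by (simp add: G_def \<pi>_self)
  have f_eq: "?f z = z + cnj (G z)" if "norm z \<le> r" for z
    using that by (simp add: G_def \<pi>_self)
  show "starlike_wrt 0 (inside (?f ` sphere 0 r))"
    unfolding ins starlike_wrt_def
  proof (intro conjI ballI subsetI)
    show "0 \<in> ?f ` ball 0 r" using r g0 by (intro image_eqI[of _ _ 0]) auto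
    fix w p assume "w \<in> ?f ` ball 0 r" and p: "p \<in> closed_segment 0 w"
    then obtain z where z: "norm z < r" "w = ?f z" by auto
    from p obtain t where t: "0 \<le> t" "t \<le> 1" "p = of_real t * w"
      by (auto simp: closed_segment_def scaleR_conv_of_real)
    obtain v where v: "v + cnj (G v) = p" by (rule contraction_perturbation_surj[OF lipG])
    have "norm v \<le> norm z"
      using z v t f_eq[of z] by (intro contraction_perturbation_starlike[OF lipG G0 t(1,2)]) auto
    hence "norm v < r" using z by simp
    thus "p \<in> ?f ` ball 0 r" using f_eq[of v] v by (intro image_eqI[of _ _ v]) auto
  qed
qed

lemma Re_quotient_perturbed_units_nonneg:
  assumes "norm A \<le> 1/2" "norm B \<le> 1/2"
  shows "Re ((1 + B) / (1 + A)) \<ge> 0"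
proof -
  have "Re ((1 + B) / (1 + A)) = Re ((1 + B) * cnj (1 + A)) / (norm (1 + A))\<^sup>2"
    by (metis Re_divide_of_real complex_div_cnj)
  thus ?thesis using Re_mult_cnj_perturbed_units[OF assms] by simp
qed

text \<open>
  With \<open>e t = \<rho> cis t\<close> the curve relative to its centre is \<open>w = e (1 + B)\<close>, and its derivative is
  \<open>\<i> e (1 + A)\<close>, with \<open>A\<close> and \<open>B\<close> of norm at most \<open>1/2\<close>. Since \<open>1 + B\<close> avoids the branch cut of the
  logarithm, \<open>t + Im (Ln (1 + B))\<close> is a continuous argument of \<open>w\<close>. Its derivative is \<open>Im (w'/w)\<close>,
  that is, the real part of \<open>(1 + A) / (1 + B)\<close>.
\<close>
lemma curve_starlike_perturbation:
  assumes holo: "g holomorphic_on unit_disc"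
    and bound: "\<And>z. z \<in> unit_disc \<Longrightarrow> norm (deriv g z) \<le> 1/2"
    and \<zeta>: "\<zeta> \<in> unit_disc" and \<rho>: "\<rho> > 0"
    and arc: "\<And>t. t \<in> {s..u} \<Longrightarrow> \<zeta> + of_real \<rho> * cis t \<in> unit_disc"
  shows "curve_starlike_wrt (\<zeta> + cnj (g \<zeta>))
    (\<lambda>t. (\<zeta> + of_real \<rho> * cis t) + cnj (g (\<zeta> + of_real \<rho> * cis t))) s u"
proof -
  have lip: "norm (g x - g y) \<le> norm (x - y) / 2" if "x \<in> unit_disc" "y \<in> unit_disc" for x y
    using lipschitz_of_deriv_le_half[OF holo _ that] bound by blast
  define e where "e t = of_real \<rho> * cis t" for t
  define z where "z t = \<zeta> + e t" for t
  define w where "w t = e t + cnj (g (z t) - g \<zeta>)" for t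
  define p where "p t = w t / e t" for t
  have e_nz: "e t \<noteq> 0" for t using \<rho> by (simp add: e_def)
  have norm_e: "norm (e t) = \<rho>" for t using \<rho> by (simp add: e_def norm_mult)
  have z_in: "z t \<in> unit_disc" if "t \<in> {s..u}" for t using arc[OF that] by (simp add: z_def e_def)
  define B where "B t = cnj (g (z t) - g \<zeta>) / e t" for t
  have B: "norm (B t) \<le> 1/2" if "t \<in> {s..u}" for t
    using lip[OF z_in[OF that] \<zeta>] \<rho>
    by (simp add: B_def norm_divide norm_e z_def divide_simps del: complex_cnj_diff)
  have p_eq: "p t = 1 + B t" for t using e_nz[of t] by (simp add: p_def B_def w_def field_simps)
  have p_slit: "p t \<notin> \<real>\<^sub>\<le>\<^sub>0" if "t \<in> {s..u}" for t
  proof -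
    have "Re (p t) > 0" using abs_Re_le_cmod[of "B t"] B[OF that] by (simp add: p_eq)
    thus ?thesis by (auto simp: complex_nonpos_Reals_iff)
  qed
  define A where "A t = - cnj (e t * deriv g (z t)) / e t" for t
  have A: "norm (A t) \<le> 1/2" if "t \<in> {s..u}" for t
    using bound[OF z_in[OF that]] e_nz[of t] by (simp add: A_def norm_divide norm_mult)
  define \<phi> where "\<phi> t = t + Im (Ln (p t))" for t
  have e_deriv: "(e has_vector_derivative \<i> * e t) (at t)" for t
  proof -
    have "((\<lambda>t. of_real \<rho> * exp (\<i> * of_real t)) has_vector_derivative \<i> * e t) (at t)"
      by (rule has_vector_derivative_real_field)
        (auto intro!: derivative_eq_intros simp: e_def cis_conv_exp)
    thus ?thesis by (simp add: e_def[abs_def] cis_conv_exp)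
  qed
  have \<phi>_deriv: "(\<phi> has_real_derivative Re ((1 + A t) / (1 + B t))) (at t)" if t: "t \<in> {s..u}" for t
  proof -
    have "((g \<circ> z) has_vector_derivative (\<i> * e t) * deriv g (z t)) (at t)"
    proof (rule field_vector_diff_chain_at)
      show "(z has_vector_derivative \<i> * e t) (at t)"
        unfolding z_def[abs_def] using has_vector_derivative_add[OF has_vector_derivative_const e_deriv] by simp
      show "(g has_field_derivative deriv g (z t)) (at (z t))"
        using z_in[OF t] by (intro holomorphic_derivI[OF holo]) auto
    qed
    hence "(w has_vector_derivative (\<i> * e t + cnj ((\<i> * e t) * deriv g (z t) - 0))) (at t)"
      unfolding w_def[abs_def] o_def
      by (intro has_vector_derivative_add has_vector_derivative_cnj has_vector_derivative_diff
           has_vector_derivative_const e_deriv)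
    also have "\<i> * e t + cnj ((\<i> * e t) * deriv g (z t) - 0) = \<i> * e t * (1 + A t)"
      using e_nz[of t] by (simp add: A_def field_simps)
    finally have w': "(w has_vector_derivative \<i> * e t * (1 + A t)) (at t)" .
    have e_inv: "((\<lambda>t. inverse (e t)) has_vector_derivative - \<i> / e t) (at t)"
      using field_vector_diff_chain_at[OF e_deriv DERIV_inverse[OF e_nz[of t]]] e_nz[of t]
      by (simp add: o_def field_simps power2_eq_square)
    have "(p has_vector_derivative w t * (- \<i> / e t) + \<i> * e t * (1 + A t) * inverse (e t)) (at t)"
      unfolding p_def[abs_def] divide_inverse[of "w _"] using has_vector_derivative_mult[OF w' e_inv] .
    also have "w t * (- \<i> / e t) + \<i> * e t * (1 + A t) * inverse (e t) = \<i> * (A t - B t)"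
      using e_nz[of t] by (simp add: w_def B_def field_simps)
    finally have "((Ln \<circ> p) has_vector_derivative \<i> * (A t - B t) * inverse (p t)) (at t)"
      by (rule field_vector_diff_chain_at) (rule has_field_derivative_Ln[OF p_slit[OF t]])
    hence "((\<lambda>t. Im ((Ln \<circ> p) t)) has_real_derivative Im (\<i> * (A t - B t) * inverse (p t))) (at t)"
      by (simp add: has_vector_derivative_complex_iff)
    hence "(\<phi> has_real_derivative 1 + Im (\<i> * (A t - B t) * inverse (p t))) (at t)"
      unfolding \<phi>_def[abs_def] o_def by (intro DERIV_add DERIV_ident)
    moreover have "1 + Im (\<i> * (A t - B t) * inverse (p t)) = Re ((1 + A t) / (1 + B t))"
    proof -
      have "p t \<noteq> 0" using p_slit[OF t] by auto
      hence "(1 + A t) / (1 + B t) = 1 + (A t - B t) * inverse (p t)" by (simp add: p_eq field_simps)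
      moreover have "Im (\<i> * (A t - B t) * inverse (p t)) = Re ((A t - B t) * inverse (p t))"
        by (simp only: mult.assoc Im_i_times)
      ultimately show ?thesis by (metis plus_complex.sel(1) one_complex.sel(1))
    qed
    ultimately show ?thesis by metis
  qed
  have "continuous_on {s..u} \<phi>"
    using \<phi>_deriv by (meson DERIV_isCont continuous_at_imp_continuous_on)
  moreover have "mono_on {s..u} \<phi>"
  proof (rule mono_onI)
    fix x y assume xy: "x \<in> {s..u}" "y \<in> {s..u}" "x \<le> y"
    show "\<phi> x \<le> \<phi> y"
      by (rule deriv_nonneg_imp_mono[of x y \<phi> "\<lambda>t. Re ((1 + A t) / (1 + B t))"])
        (use xy in \<open>auto intro!: \<phi>_deriv Re_quotient_perturbed_units_nonneg A B\<close>)
  qed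
  moreover have "w t \<noteq> 0 \<and> w t = of_real (norm (w t)) * cis (\<phi> t)" if "t \<in> {s..u}" for t
  proof -
    have pn: "p t \<noteq> 0" using p_slit[OF that] by auto
    have "p t = of_real (norm (p t)) * cis (Im (Ln (p t)))"
      using pn by (metis Arg_eq_Im_Ln rcis_cmod_Arg rcis_def)
    moreover have w: "w t = p t * e t" using e_nz[of t] by (simp add: p_def)
    ultimately have "w t = of_real (norm (p t)) * cis (Im (Ln (p t))) * (of_real \<rho> * cis t)"
      by (simp add: e_def)
    also have "\<dots> = of_real (norm (p t) * \<rho>) * cis (\<phi> t)"
      by (simp add: \<phi>_def mult_ac flip: cis_mult)
    also have "norm (p t) * \<rho> = norm (w t)" by (simp add: w norm_mult norm_e)
    finally show ?thesis using w pn e_nz[of t] by simp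
  qed
  moreover have "(\<zeta> + of_real \<rho> * cis t) + cnj (g (\<zeta> + of_real \<rho> * cis t)) - (\<zeta> + cnj (g \<zeta>)) = w t" for t
    by (simp add: w_def z_def e_def)
  ultimately show ?thesis unfolding curve_starlike_wrt_def by (metis right_minus_eq)
qed

lemma C1_on_harmonic:
  assumes holo: "g holomorphic_on unit_disc"
  shows "C1_on unit_disc (\<lambda>z. z + cnj (g z))"
  unfolding C1_on_def
proof (intro exI conjI ballI)
  let ?D = "\<lambda>z. id_blinfun + (Blinfun cnj o\<^sub>L blinfun_mult_right (deriv g z))"
  show "((\<lambda>z. z + cnj (g z)) has_derivative blinfun_apply (?D z)) (at z)" if "z \<in> unit_disc" for z
  proof -
    have "(g has_derivative (*) (deriv g z)) (at z)"
      using that holomorphic_derivI[OF holo _ that] by (simp add: has_field_derivative_def)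
    hence "((\<lambda>z. z + cnj (g z)) has_derivative (\<lambda>v. v + cnj (deriv g z * v))) (at z)"
      by (intro has_derivative_add has_derivative_ident has_derivative_cnj)
    moreover have "blinfun_apply (?D z) = (\<lambda>v. v + cnj (deriv g z * v))"
      by (rule ext) (simp add: plus_blinfun.rep_eq bounded_linear_Blinfun_apply[OF bounded_linear_cnj])
    ultimately show ?thesis by simp
  qed
  have "continuous_on unit_disc (deriv g)"
    by (intro holomorphic_on_imp_continuous_on holomorphic_deriv holo) auto
  thus "continuous_on unit_disc ?D"
    by (intro continuous_intros bounded_linear.continuous_on[OF bounded_linear_blinfun_mult_right])
qed

text \<open>
  The constant \<open>1/2\<close> bounds both the derivative and, on the convex disc, all difference quotients
  of \<open>g\<close>. The first controls the tangent of an image curve, the second its position vector.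
\<close>
lemma class_US_of_deriv_le_half:
  assumes holo: "g holomorphic_on unit_disc" and g0: "g 0 = 0"
    and bound: "\<And>z. z \<in> unit_disc \<Longrightarrow> norm (deriv g z) \<le> 1/2"
  shows "(\<lambda>z. z + cnj (g z)) \<in> class_US"
proof -
  let ?f = "\<lambda>z. z + cnj (g z)"
  have lip: "norm (g x - g y) \<le> norm (x - y) / 2" if "x \<in> unit_disc" "y \<in> unit_disc" for x y
    using lipschitz_of_deriv_le_half[OF holo _ that] bound by blast
  have decomp: "canonical_decomposition ?f (\<lambda>z. z) g"
    unfolding canonical_decomposition_def
  proof (intro conjI)
    show "\<exists>a. \<forall>z\<in>unit_disc. (\<lambda>n. a (n + 2) * z ^ (n + 2)) sums (z - z)"
      by (intro exI[of _ "\<lambda>_. 0"]) simp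
    show "\<exists>b. \<forall>z\<in>unit_disc. (\<lambda>n. b (n + 1) * z ^ (n + 1)) sums g z"
    proof (intro exI ballI)
      fix z assume "z \<in> unit_disc"
      from holomorphic_power_series[OF holo this]
      show "(\<lambda>n. (deriv ^^ (n + 1)) g 0 / fact (n + 1) * z ^ (n + 1)) sums g z"
        using sums_iff_shift'[of "\<lambda>n. (deriv ^^ n) g 0 / fact n * z ^ n" 1 "g z"] g0 by simp
    qed
  qed (use holo in \<open>auto simp: analytic_on_open\<close>)
  have "(norm (deriv (\<lambda>z. z) z))\<^sup>2 - (norm (deriv g z))\<^sup>2 > 0" if "z \<in> unit_disc" for z
    using power_mono[OF bound[OF that], of 2] by (simp add: power2_eq_square)
  hence "sense_preserving ?f" using decomp unfolding sense_preserving_def by blast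
  moreover have "inj_on ?f unit_disc" by (rule inj_on_perturbation[OF lip])
  moreover have "fully_starlike ?f"
    by (rule fully_starlike_perturbation[OF lip holomorphic_on_imp_continuous_on[OF holo] g0])
  ultimately show ?thesis
    using decomp C1_on_harmonic[OF holo] curve_starlike_perturbation[OF holo bound]
    unfolding class_US_def class_SH_def class_H_def uniformly_starlike_def by blast
qed

section \<open>The inequality in Gauss's summation theorem\<close>

text \<open>
  The common feature of the two cases of the theorem, real parameters and conjugate parameters: all
  factors \<open>(a + j) (b + j)\<close> of the hypergeometric coefficients are nonnegative reals. The condition
  is symmetric and is inherited by \<open>a + 1\<close>, \<open>b + 1\<close>. It is also the condition on \<open>c - a\<close>, \<open>c - b\<close>
  under which the inequalities below can be multiplied.
\<close>
definition nonneg_shift_products :: "complex \<Rightarrow> complex \<Rightarrow> bool" where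
  "nonneg_shift_products a b \<longleftrightarrow> (\<forall>j::nat. (a + of_nat j) * (b + of_nat j) \<in> \<real>\<^sub>\<ge>\<^sub>0)"

text \<open>
  The coefficients are taken in the reals, so that partial sums can be compared; under
  \<open>nonneg_shift_products a b\<close> the product of the two rising factorials is real and nothing is lost.
\<close>
definition gauss_coeff :: "complex \<Rightarrow> complex \<Rightarrow> real \<Rightarrow> nat \<Rightarrow> real" where
  "gauss_coeff a b c n = Re (pochhammer a n * pochhammer b n) / (pochhammer c n * fact n)"

lemma pochhammer_product_nonneg:
  assumes "nonneg_shift_products a b"
  shows "pochhammer a n * pochhammer b n \<in> \<real>\<^sub>\<ge>\<^sub>0"
proof (induction n)
  case (Suc n)
  have "pochhammer a (Suc n) * pochhammer b (Suc n) =
    (pochhammer a n * pochhammer b n) * ((a + of_nat n) * (b + of_nat n))"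
    by (simp add: pochhammer_Suc)
  with Suc assms show ?case
    unfolding nonneg_shift_products_def by (metis nonneg_Reals_mult_I)
qed simp

lemma Re_pochhammer_product_Suc:
  assumes "nonneg_shift_products a b"
  shows "Re (pochhammer a (Suc n) * pochhammer b (Suc n)) =
    Re (pochhammer a n * pochhammer b n) * Re ((a + of_nat n) * (b + of_nat n))"
proof -
  have "Im (pochhammer a n * pochhammer b n) = 0"
    using pochhammer_product_nonneg[OF assms] by (simp add: complex_nonneg_Reals_iff)
  moreover have "pochhammer a (Suc n) * pochhammer b (Suc n) =
    (pochhammer a n * pochhammer b n) * ((a + of_nat n) * (b + of_nat n))"
    by (simp add: pochhammer_Suc)
  ultimately show ?thesis by (simp only: times_complex.sel mult_zero_left diff_zero)
qed

lemma gauss_coeff_nonneg: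
  assumes "nonneg_shift_products a b" "c > 0"
  shows "gauss_coeff a b c n \<ge> 0"
  using pochhammer_product_nonneg[OF assms(1), of n] assms(2)
  by (auto simp: gauss_coeff_def complex_nonneg_Reals_iff pochhammer_nonneg intro!: divide_nonneg_nonneg mult_nonneg_nonneg)

lemma of_real_gauss_coeff:
  assumes "nonneg_shift_products a b"
  shows "of_real (gauss_coeff a b c n) =
    pochhammer a n * pochhammer b n / (pochhammer (of_real c) n * fact n)"
proof -
  have "of_real (Re (pochhammer a n * pochhammer b n)) = pochhammer a n * pochhammer b n"
    using pochhammer_product_nonneg[OF assms, of n] nonneg_Reals_subset_Reals by (metis of_real_Re subsetD)
  thus ?thesis by (simp add: gauss_coeff_def pochhammer_of_real)
qed

lemma gauss_coeff_0 [simp]: "gauss_coeff a b c 0 = 1"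
  by (simp add: gauss_coeff_def)

lemma gauss_coeff_Suc:
  assumes "nonneg_shift_products a b"
  shows "gauss_coeff a b c (Suc n) =
    gauss_coeff a b c n * (Re ((a + of_nat n) * (b + of_nat n)) / ((c + n) * (n + 1)))"
  unfolding gauss_coeff_def Re_pochhammer_product_Suc[OF assms]
  by (simp add: pochhammer_Suc field_simps)

lemma gauss_coeff_plus1:
  assumes "c > 0"
  shows "gauss_coeff a b (c + 1) n = gauss_coeff a b c n * (c / (c + n))"
proof -
  have "c * pochhammer (c + 1) n = pochhammer c n * (c + n)"
    using pochhammer_rec[of c n] pochhammer_Suc[of c n] by simp
  hence "pochhammer (c + 1) n = pochhammer c n * (c + n) / c" using assms by (simp add: field_simps)
  thus ?thesis by (simp add: gauss_coeff_def)
qed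

text \<open>
  Gauss's contiguity relation \<open>c (c - a - b) F(a, b; c; 1) = (c - a) (c - b) F(a, b; c + 1; 1)\<close> in a
  form for partial sums. Termwise, the difference of the two sides telescopes with
  \<open>u n = c n \<cdot> gauss_coeff a b c n\<close>; the last term is the boundary contribution, and it has a sign.
\<close>
lemma gauss_partial_sum_contiguity:
  fixes a b :: complex and c :: real
  assumes ab: "nonneg_shift_products a b" and c: "c > 0"
  shows "c * (c - Re (a + b)) * (\<Sum>n<N. gauss_coeff a b c n) =
    Re ((of_real c - a) * (of_real c - b)) * (\<Sum>n<N. gauss_coeff a b (c + 1) n)
      - c * N * gauss_coeff a b c N"
proof (induction N)
  case (Suc N)
  define A where "A = gauss_coeff a b c N"
  have cN: "c + N > 0" using c by simp
  have 1: "c * real (Suc N) * gauss_coeff a b c (Suc N) =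
      c * (A * (Re ((a + of_nat N) * (b + of_nat N)) / (c + N)))"
  proof -
    have "c * x * (A * (r / (d * x))) = c * (A * (r / d))" if "x > 0" for x r d :: real
      using that by simp
    from this[of "real (Suc N)"] show ?thesis
      unfolding gauss_coeff_Suc[OF ab] A_def by (simp add: add.commute)
  qed
  define p where "p = Re (a * b)"
  define s where "s = Re (a + b)"
  define K where "K = Re ((of_real c - a) * (of_real c - b))"
  define R where "R = Re ((a + of_nat N) * (b + of_nat N))"
  have K: "K = c * c - c * s + p" and R: "R = p + N * s + N * N"
    by (simp_all add: K_def R_def p_def s_def algebra_simps)
  have 2: "c * (c - s) * A = K * (A * (c / (c + N))) - c * (A * (R / (c + N))) + c * N * A"
  proof -
    define d where "d = c + N"
    have "d \<noteq> 0" using cN by (simp add: d_def)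
    moreover have "c * (c - s) * A * d = K * A * c - c * A * R + c * N * A * d"
      unfolding K R d_def by (simp add: algebra_simps)
    ultimately show ?thesis unfolding d_def[symmetric] by (simp add: divide_simps mult_ac)
  qed
  show ?case
    using Suc.IH 2
    unfolding sum.lessThan_Suc distrib_left[of _ "sum _ _"] 1 gauss_coeff_plus1[OF c, of a b N]
      A_def[symmetric] K_def[symmetric] R_def[symmetric] s_def[symmetric] by linarith
qed simp

text \<open>
  Dropping the nonpositive boundary term and iterating \<open>m\<close> times. Each factor that multiplies the
  inequality is nonnegative, which is where the condition on \<open>c - a\<close> and \<open>c - b\<close> enters.
\<close>
lemma gauss_partial_sum_le_shifted:
  fixes a b :: complex and c :: real
  assumes ab: "nonneg_shift_products a b"
    and cab: "nonneg_shift_products (of_real c - a) (of_real c - b)"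
    and c: "c > 0" "c > Re (a + b)"
  shows "(\<Sum>n<N. gauss_coeff a b c n) \<le>
    Re (pochhammer (of_real c - a) m * pochhammer (of_real c - b) m) /
      (pochhammer c m * pochhammer (c - Re (a + b)) m) * (\<Sum>n<N. gauss_coeff a b (c + m) n)"
proof (induction m)
  case (Suc m)
  define P where "P = Re (pochhammer (of_real c - a) m * pochhammer (of_real c - b) m) /
      (pochhammer c m * pochhammer (c - Re (a + b)) m)"
  define R where "R = Re ((of_real c - a + of_nat m) * (of_real c - b + of_nat m))"
  define d where "d = c + m"
  have d: "d > 0" "d - Re (a + b) > 0" using c by (auto simp: d_def)
  have R: "R = Re ((of_real d - a) * (of_real d - b))"
    by (simp add: R_def d_def algebra_simps)
  have P: "P \<ge> 0"
    using pochhammer_product_nonneg[OF cab, of m] c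
    by (auto simp: P_def complex_nonneg_Reals_iff pochhammer_nonneg
        intro!: divide_nonneg_nonneg mult_nonneg_nonneg)
  have "d * (d - Re (a + b)) * (\<Sum>n<N. gauss_coeff a b d n) \<le> R * (\<Sum>n<N. gauss_coeff a b (d + 1) n)"
    using gauss_partial_sum_contiguity[OF ab d(1), of N] gauss_coeff_nonneg[OF ab d(1), of N] d(1)
    by (simp add: R)
  hence "(\<Sum>n<N. gauss_coeff a b d n) \<le> R / (d * (d - Re (a + b))) * (\<Sum>n<N. gauss_coeff a b (d + 1) n)"
    using mult_pos_pos[OF d]
    by (simp only: pos_le_divide_eq times_divide_eq_left mult.commute[of "sum _ _" "_ * _"])
  with P have "P * (\<Sum>n<N. gauss_coeff a b d n) \<le>
      P * (R / (d * (d - Re (a + b))) * (\<Sum>n<N. gauss_coeff a b (d + 1) n))"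
    by (rule mult_left_mono[rotated])
  also have "\<dots> = Re (pochhammer (of_real c - a) (Suc m) * pochhammer (of_real c - b) (Suc m)) /
      (pochhammer c (Suc m) * pochhammer (c - Re (a + b)) (Suc m)) *
      (\<Sum>n<N. gauss_coeff a b (c + Suc m) n)"
    unfolding Re_pochhammer_product_Suc[OF cab] P_def R_def[symmetric]
    by (simp add: pochhammer_Suc d_def algebra_simps)
  finally show ?case using Suc.IH unfolding P_def[symmetric] d_def[symmetric] by simp
qed simp

lemma gauss_coeff_tendsto:
  assumes "nonneg_shift_products a b"
  shows "(\<lambda>m. gauss_coeff a b (c + real m) n) \<longlonglongrightarrow> (if n = 0 then 1 else 0)"
proof (induction n)
  case (Suc n)
  have "(\<lambda>m. gauss_coeff a b (c + real m) n *
      (Re ((a + of_nat n) * (b + of_nat n)) / ((c + real m + n) * (n + 1)))) \<longlonglongrightarrow>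
      (if n = 0 then 1 else 0) * 0"
    by (intro tendsto_mult Suc.IH) real_asymp
  thus ?case unfolding gauss_coeff_Suc[OF assms] by simp
qed simp

text \<open>
  Euler's limit \<open>rGamma z = lim pochhammer z (m + 1) / (m! m powr z)\<close>, applied to four arguments. The
  factorials cancel, and so do the powers of \<open>m\<close>, because \<open>(c - a) + (c - b) = c + (c - a - b)\<close>.
  Since \<open>rGamma\<close> is entire, only the denominators \<open>rGamma c\<close> and \<open>rGamma (c - a - b)\<close> have to be
  kept away from zero.
\<close>
lemma gauss_gamma_product_tendsto:
  assumes "c > 0" "c > Re (a + b)" "a + b \<in> \<real>"
  shows "(\<lambda>m. pochhammer (of_real c - a) (Suc m) * pochhammer (of_real c - b) (Suc m) /
      (pochhammer (of_real c) (Suc m) * pochhammer (of_real (c - Re (a + b))) (Suc m)))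
    \<longlonglongrightarrow> gamma_ratio a b c 0"
proof -
  let ?c = "complex_of_real c" and ?d = "complex_of_real (c - Re (a + b))"
  have d: "?d = ?c - a - b" using assms(3) by (metis diff_diff_eq of_real_diff of_real_Re)
  have nz: "rGamma ?c \<noteq> 0" "rGamma ?d \<noteq> 0"
    using assms by (auto simp: rGamma_eq_zero_iff of_real_in_nonpos_Ints_iff simp del: of_real_diff)
  have "(\<lambda>m. rGamma_series (?c - a) m * rGamma_series (?c - b) m /
      (rGamma_series ?c m * rGamma_series ?d m)) \<longlonglongrightarrow>
      rGamma (?c - a) * rGamma (?c - b) / (rGamma ?c * rGamma ?d)"
    using nz by (intro tendsto_intros rGamma_series_LIMSEQ) auto
  also have "rGamma (?c - a) * rGamma (?c - b) / (rGamma ?c * rGamma ?d) = gamma_ratio a b c 0"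
    unfolding gamma_ratio_def rGamma_inverse_Gamma d by (simp add: field_simps)
  finally show ?thesis
  proof (rule Lim_transform_eventually)
    show "eventually (\<lambda>m. rGamma_series (?c - a) m * rGamma_series (?c - b) m /
      (rGamma_series ?c m * rGamma_series ?d m) =
      pochhammer (?c - a) (Suc m) * pochhammer (?c - b) (Suc m) /
      (pochhammer ?c (Suc m) * pochhammer ?d (Suc m))) sequentially"
    proof (rule always_eventually, rule allI)
      fix m
      define E where "E z = exp (z * of_real (ln (real m)))" for z :: complex
      have "E (?c - a) * E (?c - b) = E ?c * E ?d"
        unfolding E_def d exp_add[symmetric] by (simp add: algebra_simps)
      moreover have "E z \<noteq> 0" for z by (simp add: E_def)
      ultimately show "rGamma_series (?c - a) m * rGamma_series (?c - b) m /
      (rGamma_series ?c m * rGamma_series ?d m) =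
      pochhammer (?c - a) (Suc m) * pochhammer (?c - b) (Suc m) /
      (pochhammer ?c (Suc m) * pochhammer ?d (Suc m))"
        unfolding rGamma_series_def E_def[symmetric] by (simp add: mult.assoc mult.left_commute divide_simps)
    qed
  qed
qed

lemma nonneg_shift_products_sum_real:
  assumes "nonneg_shift_products a b"
  shows "a + b \<in> \<real>"
proof -
  have "a * b \<in> \<real>\<^sub>\<ge>\<^sub>0" "(a + 1) * (b + 1) \<in> \<real>\<^sub>\<ge>\<^sub>0"
    using assms[unfolded nonneg_shift_products_def, rule_format, of 0]
      assms[unfolded nonneg_shift_products_def, rule_format, of 1] by auto
  thus ?thesis by (simp add: complex_nonneg_Reals_iff complex_is_Real_iff algebra_simps)
qed

text \<open>
  As \<open>m\<close> tends to infinity with the number of terms fixed, all terms of the shifted sum except the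
  first tend to \<open>0\<close>. Since the coefficients are nonnegative, the bound also yields
  convergence of the series at \<open>1\<close>.
\<close>
lemma gauss_partial_sum_le:
  fixes a b :: complex and c :: real
  assumes ab: "nonneg_shift_products a b"
    and cab: "nonneg_shift_products (of_real c - a) (of_real c - b)"
    and c: "c > 0" "c > Re (a + b)"
  shows "(\<Sum>n<N. gauss_coeff a b c n) \<le> Re (gamma_ratio a b c 0)"
proof -
  let ?P = "\<lambda>m. pochhammer (of_real c - a) m * pochhammer (of_real c - b) m"
  let ?Q = "\<lambda>m. pochhammer c m * pochhammer (c - Re (a + b)) m"
  have "?P m / (pochhammer (of_real c) m * pochhammer (of_real (c - Re (a + b))) m) =
      ?P m / of_real (?Q m)" for m by (simp add: pochhammer_of_real del: of_real_diff)
  hence "(\<lambda>m. Re (?P (Suc m) / of_real (?Q (Suc m)))) \<longlonglongrightarrow> Re (gamma_ratio a b c 0)"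
    using tendsto_Re[OF gauss_gamma_product_tendsto[OF c nonneg_shift_products_sum_real[OF ab]]] by presburger
  \<comment> \<open>One more term than asked for, so that the sum contains the constant term even if \<open>N = 0\<close>.\<close>
  hence "(\<lambda>m. Re (?P (Suc m)) / ?Q (Suc m) * (\<Sum>n<Suc N. gauss_coeff a b (c + Suc m) n))
      \<longlonglongrightarrow> Re (gamma_ratio a b c 0) * (\<Sum>n<Suc N. if n = 0 then 1 else 0)"
    unfolding Re_divide_of_real
    by (intro tendsto_mult tendsto_sum LIMSEQ_Suc[OF gauss_coeff_tendsto[OF ab]])
  hence "(\<Sum>n<Suc N. gauss_coeff a b c n) \<le> Re (gamma_ratio a b c 0) * (\<Sum>n<Suc N. if n = 0 then 1 else 0)"
    by (rule LIMSEQ_le_const) (use gauss_partial_sum_le_shifted[OF ab cab c] in blast)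
  also have "(\<Sum>n<Suc N. if n = 0 then 1 else 0 :: real) = 1"
    by (simp add: sum.delta del: sum.lessThan_Suc)
  finally show ?thesis
    using gauss_coeff_nonneg[OF ab c(1), of N] by simp
qed

section \<open>Bounds for the hypergeometric function and its derivative\<close>

lemma gauss_coeff_summable:
  assumes "nonneg_shift_products a b" "nonneg_shift_products (of_real c - a) (of_real c - b)"
    and "c > 0" "c > Re (a + b)"
  shows "summable (gauss_coeff a b c)"
    and "(\<Sum>n. gauss_coeff a b c n) \<le> Re (gamma_ratio a b c 0)"
proof -
  show sm: "summable (gauss_coeff a b c)"
    by (rule summableI_nonneg_bounded[OF gauss_coeff_nonneg[OF assms(1,3)] gauss_partial_sum_le[OF assms]])
  show "(\<Sum>n. gauss_coeff a b c n) \<le> Re (gamma_ratio a b c 0)"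
    by (rule suminf_le_const[OF sm gauss_partial_sum_le[OF assms]])
qed

lemma hyp2F1_eq_gauss_series:
  assumes "nonneg_shift_products a b"
  shows "hyp2F1 a b (of_real c) z = (\<Sum>n. of_real (gauss_coeff a b c n) * z ^ n)"
  unfolding hyp2F1_def of_real_gauss_coeff[OF assms] ..

lemma norm_hyp2F1_le_gamma_ratio:
  assumes "nonneg_shift_products a b" "nonneg_shift_products (of_real c - a) (of_real c - b)"
    and "c > 0" "c > Re (a + b)" and z: "z \<in> unit_disc"
  shows "norm (hyp2F1 a b (of_real c) z) \<le> Re (gamma_ratio a b c 0)"
proof -
  note sm = gauss_coeff_summable[OF assms(1-4)]
  have "norm (of_real (gauss_coeff a b c n) * z ^ n) \<le> gauss_coeff a b c n" for n
    using z gauss_coeff_nonneg[OF assms(1,3), of n] power_le_one[of "norm z" n]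
    by (auto simp: norm_mult norm_power intro!: mult_left_le)
  hence "norm (hyp2F1 a b (of_real c) z) \<le> (\<Sum>n. gauss_coeff a b c n)"
    unfolding hyp2F1_eq_gauss_series[OF assms(1)] by (intro norm_suminf_le sm(1)) auto
  thus ?thesis using sm(2) by simp
qed

lemma nonneg_shift_products_Suc:
  assumes "nonneg_shift_products a b"
  shows "nonneg_shift_products (a + 1) (b + 1)"
  unfolding nonneg_shift_products_def
proof
  fix j show "(a + 1 + of_nat j) * (b + 1 + of_nat j) \<in> \<real>\<^sub>\<ge>\<^sub>0"
    using assms[unfolded nonneg_shift_products_def, rule_format, of "Suc j"] by (simp add: add_ac)
qed

lemma hyp2F1_has_field_derivative:
  assumes ab: "nonneg_shift_products a b" and "nonneg_shift_products (of_real c - a) (of_real c - b)"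
    and c: "c > 0" "c > Re (a + b)" and z: "z \<in> unit_disc"
  shows "(hyp2F1 a b (of_real c) has_field_derivative
    a * b / of_real c * hyp2F1 (a + 1) (b + 1) (of_real (c + 1)) z) (at z)"
proof -
  let ?A = "\<lambda>n. complex_of_real (gauss_coeff a b c n)"
  have "summable (\<lambda>n. ?A n * 1 ^ n)"
    using gauss_coeff_summable(1)[OF assms(1-4)] by (simp add: summable_of_real)
  hence "((\<lambda>z. \<Sum>n. ?A n * z ^ n) has_field_derivative (\<Sum>n. diffs ?A n * z ^ n)) (at z)"
    by (rule termdiffs_strong) (use z in auto)
  moreover have "(\<lambda>z. \<Sum>n. ?A n * z ^ n) = hyp2F1 a b (of_real c)"
    by (simp add: hyp2F1_eq_gauss_series[OF ab] fun_eq_iff)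
  moreover have "(\<Sum>n. diffs ?A n * z ^ n) =
      a * b / of_real c * hyp2F1 (a + 1) (b + 1) (of_real (c + 1)) z"
  proof -
    have nz: "pochhammer (complex_of_real c) n \<noteq> 0" for n
      using c pochhammer_pos[of c n] by (simp add: pochhammer_of_real)
    have "diffs ?A n = a * b / of_real c * of_real (gauss_coeff (a + 1) (b + 1) (c + 1) n)" for n
      using c unfolding diffs_def of_real_gauss_coeff[OF ab]
        of_real_gauss_coeff[OF nonneg_shift_products_Suc[OF ab]] pochhammer_rec of_real_add of_real_1 fact_Suc
      using of_nat_neq_0[of n, where 'a = complex] by (auto simp: divide_simps)
    hence D: "diffs ?A n * z ^ n =
        a * b / of_real c * (of_real (gauss_coeff (a + 1) (b + 1) (c + 1) n) * z ^ n)" for n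
      by (simp add: mult.assoc)
    have "summable (\<lambda>n. diffs ?A n * z ^ n)"
    proof (rule termdiff_converges)
      show "norm z < 1" using z by simp
      show "summable (\<lambda>n. ?A n * x ^ n)" if "norm x < 1" for x
        using that by (intro powser_inside[OF \<open>summable (\<lambda>n. ?A n * 1 ^ n)\<close>]) simp
    qed
    \<comment> \<open>Summability of the shifted series is read off from the differentiated one, which requires
      dividing by \<open>a b\<close>.\<close>
    show ?thesis
    proof (cases "a * b = 0")
      case False
      hence "summable (\<lambda>n. of_real (gauss_coeff (a + 1) (b + 1) (c + 1) n) * z ^ n)"
        using \<open>summable (\<lambda>n. diffs ?A n * z ^ n)\<close> c unfolding D by (subst (asm) summable_cmult_iff) auto
      thus ?thesis
        unfolding D hyp2F1_eq_gauss_series[OF nonneg_shift_products_Suc[OF ab]] by (rule suminf_mult)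
    next
      case True
      show ?thesis unfolding D True by simp
    qed
  qed
  ultimately show ?thesis by simp
qed

lemma hyp2F1_0 [simp]: "hyp2F1 a b c 0 = 1"
proof -
  have "(\<lambda>n. pochhammer a n * pochhammer b n / (pochhammer c n * fact n) * 0 ^ n) sums
      (pochhammer a 0 * pochhammer b 0 / (pochhammer c 0 * fact 0))"
    by (rule powser_sums_zero)
  thus ?thesis by (simp add: hyp2F1_def sums_iff)
qed

lemma gamma_ratio_shifted_parameters:
  assumes "c > 0"
  shows "gamma_ratio (a + 1) (b + 1) (c + 1) 0 = of_real c * gamma_ratio a b c 1"
proof -
  have "complex_of_real c \<notin> \<int>\<^sub>\<le>\<^sub>0" using assms by (auto simp: of_real_in_nonpos_Ints_iff)
  hence 1: "Gamma (of_real (c + 1)) = of_real c * Gamma (complex_of_real c)"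
    by (simp add: Gamma_plus1)
  have 2: "complex_of_real (c + 1) - (a + 1) = of_real c - a"
    "complex_of_real (c + 1) - (b + 1) = of_real c - b"
    "of_real c - a - (b + 1) - of_nat 0 = of_real c - a - b - of_nat 1"
    by simp_all
  show ?thesis unfolding gamma_ratio_def 1 by (simp only: 2 times_divide_eq_right mult.assoc)
qed

lemma gamma_ratio_0_eq:
  assumes "c > Re (a + b) + 1"
  shows "gamma_ratio a b c 0 = gamma_ratio a b c 1 * (of_real c - a - b - 1)"
proof -
  have "of_real c - a - b - 1 \<notin> \<int>\<^sub>\<le>\<^sub>0"
  proof
    assume "of_real c - a - b - 1 \<in> \<int>\<^sub>\<le>\<^sub>0"
    then obtain n where "of_real c - a - b - 1 = - of_nat n" by (auto elim: nonpos_Ints_cases')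
    hence "Re (of_real c - a - b - 1) = - real n" by simp
    thus False using assms by simp
  qed
  from Gamma_plus1[OF this] show ?thesis by (simp add: gamma_ratio_def)
qed

text \<open>
  The derivative is again a hypergeometric function, up to the factor \<open>a b / c\<close>, and the raised
  parameters satisfy the hypotheses of the bound because \<open>(c + 1) - (a + 1) = c - a\<close>. The factor
  \<open>c\<close> in the shifted gamma quotient cancels the denominator.
\<close>
lemma norm_deriv_hyp2F1_le:
  assumes ab: "nonneg_shift_products a b" and cab: "nonneg_shift_products (of_real c - a) (of_real c - b)"
    and c: "c > 0" "c > Re (a + b) + 1" and z: "z \<in> unit_disc"
  shows "norm (a * b / of_real c * hyp2F1 (a + 1) (b + 1) (of_real (c + 1)) z) \<le>
    Re (a * b * gamma_ratio a b c 1)"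
proof -
  have "nonneg_shift_products (of_real (c + 1) - (a + 1)) (of_real (c + 1) - (b + 1))"
    using cab by simp
  hence F: "norm (hyp2F1 (a + 1) (b + 1) (of_real (c + 1)) z) \<le> Re (of_real c * gamma_ratio a b c 1)"
    unfolding gamma_ratio_shifted_parameters[OF c(1), symmetric] using c z
    by (intro norm_hyp2F1_le_gamma_ratio nonneg_shift_products_Suc[OF ab]) auto
  have "a * b \<in> \<real>\<^sub>\<ge>\<^sub>0"
    using ab[unfolded nonneg_shift_products_def, rule_format, of 0] by simp
  then obtain p where p: "a * b = of_real p" "p \<ge> 0" by (elim nonneg_Reals_cases)
  have "norm (a * b / of_real c * hyp2F1 (a + 1) (b + 1) (of_real (c + 1)) z) =
      p / c * norm (hyp2F1 (a + 1) (b + 1) (of_real (c + 1)) z)"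
    using p c(1) by (simp add: norm_mult norm_divide)
  also have "\<dots> \<le> p / c * Re (of_real c * gamma_ratio a b c 1)"
    using F p c(1) by (intro mult_left_mono) auto
  also have "\<dots> = Re (a * b * gamma_ratio a b c 1)" using c(1) by (simp add: p(1))
  finally show ?thesis .
qed

text \<open>
  For conjugate parameters the products are squared moduli. For real ones, \<open>a\<close> and \<open>b\<close> have the same
  sign: if both are positive, then \<open>c > a + b\<close> makes \<open>c - a\<close> and \<open>c - b\<close> positive, and if both are
  negative, then \<open>c > 0\<close> does. Parameters in \<open>(-1, 0)\<close> turn positive after one shift.
\<close>
lemma nonneg_shift_products_real_or_conj:
  assumes "(a \<in> \<real> \<and> b \<in> \<real> \<and> Re a > -1 \<and> Re b > -1 \<and> Re (a * b) > 0) \<or>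
           b = cnj a"
    and c: "c > 0" "c > Re (a + b)"
  shows "nonneg_shift_products a b" "nonneg_shift_products (of_real c - a) (of_real c - b)"
proof -
  have conj: "nonneg_shift_products w (cnj w)" for w
    unfolding nonneg_shift_products_def
  proof
    fix j :: nat
    have "(w + of_nat j) * (cnj w + of_nat j) = of_real ((norm (w + of_nat j))\<^sup>2)"
      by (metis complex_norm_square complex_cnj_add complex_cnj_of_nat of_real_power)
    thus "(w + of_nat j) * (cnj w + of_nat j) \<in> \<real>\<^sub>\<ge>\<^sub>0" by simp
  qed
  have "nonneg_shift_products a b \<and> nonneg_shift_products (of_real c - a) (of_real c - b)"
    using assms(1)
  proof
    assume "b = cnj a"
    thus ?thesis using conj[of a] conj[of "of_real c - a"] by simp
  next
    assume real: "a \<in> \<real> \<and> b \<in> \<real> \<and> Re a > -1 \<and> Re b > -1 \<and> Re (a * b) > 0"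
    then obtain x y where xy: "a = of_real x" "b = of_real y" by (auto elim!: Reals_cases)
    have ge: "x > -1" "y > -1" "x * y > 0" "c > x + y" using real c xy by auto
    hence sgn: "(0 < x \<and> 0 < y) \<or> (x < 0 \<and> y < 0)" by (simp add: zero_less_mult_iff)
    have "(x + real j) * (y + real j) \<ge> 0" for j
      using ge by (cases j) (auto intro!: mult_nonneg_nonneg)
    moreover have "(c - x + real j) * (c - y + real j) \<ge> 0" for j
      using sgn ge(4) c(1) by (intro mult_nonneg_nonneg) auto
    moreover have "(a + of_nat j) * (b + of_nat j) = of_real ((x + real j) * (y + real j))"
      "(of_real c - a + of_nat j) * (of_real c - b + of_nat j) = of_real ((c - x + real j) * (c - y + real j))"
      for j by (simp_all add: xy)
    ultimately show ?thesis unfolding nonneg_shift_products_def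
      by (metis nonneg_Reals_of_real_iff)
  qed
  thus "nonneg_shift_products a b" "nonneg_shift_products (of_real c - a) (of_real c - b)" by auto
qed

section \<open>Uniform starlikeness of the three mappings\<close>

lemma class_US_of_scaled_derivative:
  fixes G G' :: "complex \<Rightarrow> complex" and \<alpha> :: complex and M :: real
  assumes G: "\<And>z. z \<in> unit_disc \<Longrightarrow> (G has_field_derivative G' z) (at z)"
    and G0: "G 0 = 0"
    and G': "\<And>z. z \<in> unit_disc \<Longrightarrow> norm (G' z) \<le> M"
    and M: "norm \<alpha> * M \<le> 1"
  shows "(\<lambda>z. z + cnj (\<alpha> / 2 * G z)) \<in> class_US"
proof (rule class_US_of_deriv_le_half)
  have deriv: "((\<lambda>z. \<alpha> / 2 * G z) has_field_derivative \<alpha> / 2 * G' z) (at z)" if "z \<in> unit_disc" for z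
    by (rule DERIV_cmult[OF G[OF that]])
  thus "(\<lambda>z. \<alpha> / 2 * G z) holomorphic_on unit_disc"
    unfolding holomorphic_on_open[OF open_ball] by blast
  fix z assume z: "z \<in> unit_disc"
  have "norm (\<alpha> / 2 * G' z) = norm \<alpha> * norm (G' z) / 2" by (simp add: norm_mult norm_divide)
  also have "\<dots> \<le> norm \<alpha> * M / 2" using G'[OF z] by (intro divide_right_mono mult_left_mono) auto
  finally show "norm (deriv (\<lambda>z. \<alpha> / 2 * G z) z) \<le> 1/2"
    using M unfolding DERIV_imp_deriv[OF deriv[OF z]] by simp
qed (simp add: G0)

theorem theorem7:
  fixes a b \<alpha> :: complex and c :: real
  assumes "(a \<in> \<real> \<and> b \<in> \<real> \<and> Re a > -1 \<and> Re b > -1 \<and> Re (a * b) > 0) \<or>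
           (a \<noteq> 0 \<and> b \<noteq> 0 \<and> b = cnj a)"
    and "c > 0"
    and "\<alpha> \<in> unit_disc"
  shows "(c > Re (a + b) + 1 \<and>
            norm \<alpha> * Re (gamma_ratio a b c 1 * (a * b + of_real c - a - b - 1)) \<le> 1
            \<longrightarrow> f1 a b c \<alpha> \<in> class_US) \<and>
         (c > Re (a + b) + 1 \<and>
            Re (a * b * gamma_ratio a b c 1) * norm \<alpha> \<le> 1
            \<longrightarrow> f2 a b c \<alpha> \<in> class_US) \<and>
         (c > Re (a + b) \<and>
            norm \<alpha> * Re (gamma_ratio a b c 0) \<le> 1
            \<longrightarrow> f3 a b c \<alpha> \<in> class_US)"
proof (intro conjI impI)
  let ?F = "hyp2F1 a b (of_real c)"
  let ?F' = "\<lambda>z. a * b / of_real c * hyp2F1 (a + 1) (b + 1) (of_real (c + 1)) z"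
  have ab: "(a \<in> \<real> \<and> b \<in> \<real> \<and> Re a > -1 \<and> Re b > -1 \<and> Re (a * b) > 0) \<or> b = cnj a"
    using assms(1) by blast
  note nonneg = nonneg_shift_products_real_or_conj[OF ab assms(2)]
  {
    assume *: "c > Re (a + b) + 1 \<and>
      norm \<alpha> * Re (gamma_ratio a b c 1 * (a * b + of_real c - a - b - 1)) \<le> 1"
    hence c: "c > Re (a + b) + 1" "c > Re (a + b)" by auto
    \<comment> \<open>The constant of the first hypothesis is \<open>F(1) + F'(1)\<close>, which bounds the derivative of
      \<open>z F(z)\<close>.\<close>
    have M: "Re (gamma_ratio a b c 1 * (a * b + of_real c - a - b - 1)) =
        Re (gamma_ratio a b c 0) + Re (a * b * gamma_ratio a b c 1)"
      unfolding gamma_ratio_0_eq[OF c(1)] plus_complex.sel(1)[symmetric] by (simp only: algebra_simps)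
    have "(\<lambda>z. z + cnj (\<alpha> / 2 * (z * ?F z))) \<in> class_US"
    proof (rule class_US_of_scaled_derivative)
      fix z assume z: "z \<in> unit_disc"
      show "((\<lambda>z. z * ?F z) has_field_derivative ?F z + z * ?F' z) (at z)"
        using DERIV_mult[OF DERIV_ident hyp2F1_has_field_derivative[OF nonneg[OF c(2)] assms(2) c(2) z]]
        by (simp add: add.commute mult.commute)
      have "norm (?F z + z * ?F' z) \<le> norm (?F z) + norm z * norm (?F' z)"
        by (metis norm_triangle_ineq norm_mult)
      also have "\<dots> \<le> norm (?F z) + 1 * norm (?F' z)"
        using z by (intro add_left_mono mult_right_mono) auto
      also have "\<dots> \<le> Re (gamma_ratio a b c 0) + Re (a * b * gamma_ratio a b c 1)"
        using norm_hyp2F1_le_gamma_ratio[OF nonneg[OF c(2)] assms(2) c(2) z]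
          norm_deriv_hyp2F1_le[OF nonneg[OF c(2)] assms(2) c(1) z] by linarith
      finally show "norm (?F z + z * ?F' z) \<le>
        Re (gamma_ratio a b c 0) + Re (a * b * gamma_ratio a b c 1)" .
    qed (use * M in auto)
    thus "f1 a b c \<alpha> \<in> class_US" by (simp add: f1_def[abs_def] mult.assoc)
  next
    assume *: "c > Re (a + b) + 1 \<and> Re (a * b * gamma_ratio a b c 1) * norm \<alpha> \<le> 1"
    hence c: "c > Re (a + b) + 1" "c > Re (a + b)" by auto
    have "(\<lambda>z. z + cnj (\<alpha> / 2 * (?F z - 1))) \<in> class_US"
    proof (rule class_US_of_scaled_derivative)
      fix z assume z: "z \<in> unit_disc"
      show "((\<lambda>z. ?F z - 1) has_field_derivative ?F' z) (at z)"
        using DERIV_diff[OF hyp2F1_has_field_derivative[OF nonneg[OF c(2)] assms(2) c(2) z] DERIV_const]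
        by (simp only: diff_zero)
      show "norm (?F' z) \<le> Re (a * b * gamma_ratio a b c 1)"
        by (rule norm_deriv_hyp2F1_le[OF nonneg[OF c(2)] assms(2) c(1) z])
    qed (use * in \<open>simp_all add: mult.commute\<close>)
    thus "f2 a b c \<alpha> \<in> class_US" by (simp add: f2_def[abs_def])
  next
    assume *: "c > Re (a + b) \<and> norm \<alpha> * Re (gamma_ratio a b c 0) \<le> 1"
    hence c: "c > Re (a + b)" by simp
    have "?F holomorphic_on unit_disc"
      using hyp2F1_has_field_derivative[OF nonneg[OF c] assms(2) c]
      unfolding holomorphic_on_open[OF open_ball] by blast
    then obtain H where H: "\<And>z. z \<in> unit_disc \<Longrightarrow> (H has_field_derivative ?F z) (at z within unit_disc)"
      using holomorphic_convex_primitive'[of unit_disc ?F] by (metis convex_ball open_ball)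
    have int: "contour_integral (linepath 0 z) ?F = H z - H 0" if "z \<in> unit_disc" for z
    proof -
      have "closed_segment 0 z \<subseteq> unit_disc"
        using that by (intro closed_segment_subset) auto
      hence "(?F has_contour_integral H (pathfinish (linepath 0 z)) - H (pathstart (linepath 0 z))) (linepath 0 z)"
        by (intro contour_integral_primitive[OF H]) auto
      thus ?thesis by (simp add: contour_integral_unique)
    qed
    have "(\<lambda>z. z + cnj (\<alpha> / 2 * contour_integral (linepath 0 z) ?F)) \<in> class_US"
    proof (rule class_US_of_scaled_derivative)
      fix z assume z: "z \<in> unit_disc"
      have "((\<lambda>z. H z - H 0) has_field_derivative ?F z) (at z)"
        using DERIV_diff[OF H[OF z] DERIV_const] at_within_open[OF z open_ball] by simp
      thus "((\<lambda>z. contour_integral (linepath 0 z) ?F) has_field_derivative ?F z) (at z)"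
        by (rule has_field_derivative_transform_within_open[OF _ open_ball z]) (simp add: int)
      show "norm (?F z) \<le> Re (gamma_ratio a b c 0)"
        by (rule norm_hyp2F1_le_gamma_ratio[OF nonneg[OF c] assms(2) c z])
    qed (use * in simp_all)
    thus "f3 a b c \<alpha> \<in> class_US" by (simp add: f3_def[abs_def])
  }
qed

end
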